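(* A spectral measure over $\mathbb{T}^2$ of the graph $\mathcal{E}^{(24)}$ (with its distinguished vertex $\ast$) is $$\mathrm{d}\varepsilon=\frac{6-2\sqrt3-\sqrt6}{48}\,\mathrm{d}^{((24))}+\frac{6+2\sqrt3-\sqrt6}{48}\,\mathrm{d}^{((24/5))}+\frac{6+2\sqrt3+\sqrt6}{48}\,\mathrm{d}^{((24/7))}+\frac{6-2\sqrt3+\sqrt6}{48}\,\mathrm{d}^{((24/11))}+\frac{2-\sqrt2}{8}\,\mathrm{d}^{(8,1/12)}+\frac{2+\sqrt2}{8}\,\mathrm{d}^{(4,1/24)}.$$ That is, $\int_{\mathbb{T}^2}R_{m,n}\,\mathrm{d}\varepsilon=\langle \Delta^m(\Delta^{\ast})^{n}e_{\ast},e_{\ast}\rangle$ for all integers $m,n\ge 0$, where $\Delta$ is the adjacency matrix of $\mathcal{E}^{(24)}$.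
   Context: $\mathbb{T}$ is the unit circle in $\mathbb{C}$. For integers $m,n\ge0$ put $R_{m,n}(\omega_1,\omega_2)=(\omega_1+\omega_2^{-1}+\omega_1^{-1}\omega_2)^m(\omega_1^{-1}+\omega_2+\omega_1\omega_2^{-1})^{n}$. For a finite directed graph with normal adjacency matrix $\Delta$ (entry $\Delta_{v,w}$ = number of edges from $v$ to $w$) and a vertex $v$, a measure $\varepsilon$ on $\mathbb{T}^2$ is called a spectral measure over $\mathbb{T}^2$ at $v$ if $\int_{\mathbb{T}^2} R_{m,n}\,\mathrm{d}\varepsilon=\langle\Delta^m(\Delta^{\ast})^{n}e_v,e_v\rangle$ for all $m,n\ge0$, with $e_v$ the basis vector of $v$. The group $S_3$ acts on $\mathbb{T}^2$, generated by $(\omega_1,\omega_2)\mapsto(\omega_2^{-1},\omega_1^{-1})$ and $(\omega_1,\omega_2)\mapsto(\omega_2^{-1},\omega_1\omega_2^{-1})$. Let $\omega=e^{2\pi i/3}$ and, for rational $s\ge2$, $\tau=e^{2\pi i/s}$. Then $\mathrm{d}^{((s))}$ is the uniform probability measure on the union of the $S_3$-orbits of $(\tau,\tau)$, $(\overline{\omega}\,\overline{\tau},\omega)$, $(\omega,\overline{\omega}\,\overline{\tau})$; and for rational $s>2$, $0\le k\le 1/s$, $\mathrm{d}^{(s,k)}$ is the uniform probability measure on the union of the $S_3$-orbits of $(\tau e^{2\pi ik},\tau)$, $(\tau,\tau e^{2\pi ik})$, $(\overline{\omega}\,\overline{\tau},\omega e^{2\pi ik})$, $(\omega e^{2\pi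 ik},\overline{\omega}\,\overline{\tau})$, $(\overline{\omega}\,\overline{\tau}e^{-2\pi ik},\omega e^{-2\pi ik})$, $(\omega e^{-2\pi ik},\overline{\omega}\,\overline{\tau}e^{-2\pi ik})$. The graph $\mathcal{E}^{(24)}$ (the nimrep graph of the conformal inclusion $SU(3)_{21}\subset(\mathrm{E}_7)_1$) has 24 vertices $i_\epsilon,a_\epsilon,c_\epsilon,x_\epsilon$, $u_\epsilon,v_\epsilon,w_\epsilon,y_\epsilon$, $u'_\epsilon,v'_\epsilon,w'_\epsilon,y'_\epsilon$ with $\epsilon\in\mathbb{Z}/2$, and the following single edges, for each $\epsilon\in\mathbb{Z}/2$: $i_\epsilon\to u_\epsilon$; $a_\epsilon\to u_\epsilon,v_\epsilon,w_\epsilon$; $c_\epsilon\to w_\epsilon,v_{\epsilon+1},y_\epsilon$; $x_\epsilon\to w_0,w_1,y_{\epsilon+1}$; $u_\epsilon\to u'_\epsilon,v'_\epsilon$; $v_\epsilon\to u'_\epsilon,w'_\epsilon$; $w_\epsilon\to v'_\epsilon,w'_0,w'_1,y'_{\epsilon+1}$; $y_\epsilon\to w'_{\epsilon+1},y'_{\epsilon+1}$; $u'_\epsilon\to i_\epsilon,a_\epsilon$; $v'_\epsilon\to a_\epsilon,c_\epsilon$; $w'_\epsilon\to a_\epsilon,c_{\epsilon+1},x_0,x_1$; $y'_\epsilon\to c_{\epsilon+1},x_\epsilon$. The distinguished vertex is $\ast=i_0$ (a vertex of lowest Perron-Frobenius weight). *)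

theory Defs
  imports
    "HOL-Analysis.Analysis"
    "HOL-Algebra.Group_Action"
    "HOL-Algebra.Elementary_Groups"
    "Graph_Theory.Digraph"
begin

definition torus :: "(complex \<times> complex) set" where
  "torus = sphere 0 1 \<times> sphere 0 1"

definition torus_borel :: "(complex \<times> complex) measure" where
  "torus_borel = restrict_space borel torus"

definition R_fun :: "nat \<Rightarrow> nat \<Rightarrow> complex \<times> complex \<Rightarrow> complex" where
  "R_fun m n = (\<lambda>(w1, w2). (w1 + inverse w2 + inverse w1 * w2) ^ m
                      * (inverse w1 + w2 + w1 * inverse w2) ^ n)"

text \<open>The elements of \<open>BijGroup torus\<close> are extensional functions, hence the restricted
  abstractions in the two generators.\<close>

definition S3 :: "(complex \<times> complex \<Rightarrow> complex \<times> complex) monoid" where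
  "S3 = subgroup_generated (BijGroup torus)
     {\<lambda>(w1, w2) \<in> torus. (inverse w2, inverse w1),
      \<lambda>(w1, w2) \<in> torus. (inverse w2, w1 * inverse w2)}"

definition S3_orbit :: "complex \<times> complex \<Rightarrow> (complex \<times> complex) set" where
  "S3_orbit p = orbit S3 (\<lambda>g. g) p"


definition uniform_on :: "(complex \<times> complex) set \<Rightarrow> (complex \<times> complex) measure" where
  "uniform_on F = distr (uniform_count_measure F) torus_borel (\<lambda>p. p)"
  \<comment> \<open>The \<open>\<sigma>\<close>-algebra of \<open>uniform_count_measure F\<close> is \<open>Pow F\<close>; \<open>distr\<close> moves the measure to the torus.\<close>

definition omega :: complex where
  "omega = cis (2 * pi / 3)"

definition tau :: "rat \<Rightarrow> complex" where
  "tau s = cis (2 * pi / of_rat s)"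

text \<open>\<open>d1 s\<close> is $\mathrm{d}^{((s))}$, meant for $s \ge 2$; \<open>d2 s k\<close> is $\mathrm{d}^{(s,k)}$,
  meant for $s > 2$ and $0 \le k \le 1/s$.\<close>

definition d1 :: "rat \<Rightarrow> (complex \<times> complex) measure" where
  "d1 s = uniform_on (\<Union> (S3_orbit `
     {(tau s, tau s),
      (cnj omega * cnj (tau s), omega),
      (omega, cnj omega * cnj (tau s))}))"

definition d2 :: "rat \<Rightarrow> real \<Rightarrow> (complex \<times> complex) measure" where
  "d2 s k = uniform_on (\<Union> (S3_orbit `
     {(tau s * cis (2 * pi * k), tau s),
      (tau s, tau s * cis (2 * pi * k)),
      (cnj omega * cnj (tau s), omega * cis (2 * pi * k)),
      (omega * cis (2 * pi * k), cnj omega * cnj (tau s)),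
      (cnj omega * cnj (tau s) * cis (- 2 * pi * k), omega * cis (- 2 * pi * k)),
      (omega * cis (- 2 * pi * k), cnj omega * cnj (tau s) * cis (- 2 * pi * k))}))"

text \<open>Linear combinations of measures on the torus, for nonnegative coefficients only: \<open>ennreal\<close>
  sends a negative real to \<open>0\<close>.\<close>

definition torus_lincomb ::
  "(real \<times> (complex \<times> complex) measure) list \<Rightarrow> (complex \<times> complex) measure" where
  "torus_lincomb cs = measure_of torus (sets torus_borel)
     (\<lambda>A. \<Sum>(c, M) \<leftarrow> cs. ennreal c * emeasure M A)"

lemma emeasure_torus_lincomb:
  assumes "\<And>c M. (c, M) \<in> set cs \<Longrightarrow> sets M = sets torus_borel"
    and "A \<in> sets torus_borel"
  shows "emeasure (torus_lincomb cs) A = (\<Sum>(c, M) \<leftarrow> cs. ennreal c * emeasure M A)"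
proof (unfold torus_lincomb_def, rule emeasure_measure_of_sigma)
  show "sigma_algebra torus (sets torus_borel)"
    using sets.sigma_algebra_axioms[of torus_borel]
    by (simp add: torus_borel_def space_restrict_space)
  show "positive (sets torus_borel) (\<lambda>A. \<Sum>(c, M) \<leftarrow> cs. ennreal c * emeasure M A)"
    unfolding positive_def by (induction cs) auto
  show "countably_additive (sets torus_borel) (\<lambda>A. \<Sum>(c, M) \<leftarrow> cs. ennreal c * emeasure M A)"
    unfolding countably_additive_def
  proof (intro allI impI)
    fix B :: "nat \<Rightarrow> (complex \<times> complex) set"
    assume B: "range B \<subseteq> sets torus_borel" "disjoint_family B"
    show "(\<Sum>i. \<Sum>(c, M) \<leftarrow> cs. ennreal c * emeasure M (B i)) =
        (\<Sum>(c, M) \<leftarrow> cs. ennreal c * emeasure M (\<Union> (range B)))"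
      using assms(1)
    proof (induction cs)
      case Nil
      then show ?case by simp
    next
      case (Cons cM cs)
      obtain c M where cM: "cM = (c, M)" by force
      have "(\<Sum>i. emeasure M (B i)) = emeasure M (\<Union> (range B))"
        using B Cons.prems[of c M] cM by (intro suminf_emeasure) auto
      moreover have "(\<Sum>i. \<Sum>(c, M) \<leftarrow> cs. ennreal c * emeasure M (B i)) =
          (\<Sum>(c, M) \<leftarrow> cs. ennreal c * emeasure M (\<Union> (range B)))"
        by (rule Cons.IH) (use Cons.prems in auto)
      ultimately show ?case
        using cM by (simp add: suminf_add[symmetric])
    qed
  qed
qed (use assms in auto)


text \<open>The Hilbert space of a graph whose vertices have the finite type \<^typ>\<open>'v\<close> is
  \<^typ>\<open>complex ^ 'v\<close>. The library's \<open>inner\<close> on it is only the real part of \<open>hinner\<close>, and \<open>^\<close> on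
  matrices is componentwise; powers of a matrix are therefore written as iterates \<open>^^\<close> of \<open>(*v)\<close>.\<close>

definition hinner :: "complex ^ 'v \<Rightarrow> complex ^ 'v \<Rightarrow> complex" where
  "hinner x y = (\<Sum>i\<in>UNIV. x $ i * cnj (y $ i))"

definition adjoint_matrix :: "complex ^ 'v ^ 'v \<Rightarrow> complex ^ 'v ^ 'v" where
  "adjoint_matrix A = (\<chi> i j. cnj (A $ j $ i))"

definition adjacency :: "('v::finite, 'e) pre_digraph \<Rightarrow> complex ^ 'v ^ 'v" where
  "adjacency G = (\<chi> v w. of_nat (card {e \<in> arcs G. tail G e = v \<and> head G e = w}))"

definition spectral_measure ::
  "('v::finite, 'e) pre_digraph \<Rightarrow> 'v \<Rightarrow> (complex \<times> complex) measure \<Rightarrow> bool" where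
  "spectral_measure G v M \<longleftrightarrow>
     fin_digraph G \<and> verts G = UNIV \<and>
     adjacency G ** adjoint_matrix (adjacency G) = adjoint_matrix (adjacency G) ** adjacency G \<and>
     sets M = sets torus_borel \<and>
     (\<forall>m n. integrable M (R_fun m n) \<and>
        integral\<^sup>L M (R_fun m n)
        = hinner (((*v) (adjacency G) ^^ m)
                    (((*v) (adjoint_matrix (adjacency G)) ^^ n) (axis v 1)))
                 (axis v 1))"


datatype E24_label = Li | La | Lc | Lx | Lu | Lv | Lw | Ly | Lu' | Lv' | Lw' | Ly'

instance E24_label :: finite
proof
  have "UNIV = {Li, La, Lc, Lx, Lu, Lv, Lw, Ly, Lu', Lv', Lw', Ly'}"
    by (auto intro: E24_label.exhaust)
  then show "finite (UNIV :: E24_label set)"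
    by (metis finite.emptyI finite.insertI)
qed

text \<open>The type \<^typ>\<open>2\<close> is $\mathbb{Z}/2$; the vertex $x_\epsilon$ is \<open>(Lx, \<epsilon>)\<close>.\<close>

type_synonym E24_vertex = "E24_label \<times> 2"

fun E24_succ :: "E24_vertex \<Rightarrow> E24_vertex set" where
  "E24_succ (Li, \<epsilon>) = {(Lu, \<epsilon>)}"
| "E24_succ (La, \<epsilon>) = {(Lu, \<epsilon>), (Lv, \<epsilon>), (Lw, \<epsilon>)}"
| "E24_succ (Lc, \<epsilon>) = {(Lw, \<epsilon>), (Lv, \<epsilon> + 1), (Ly, \<epsilon>)}"
| "E24_succ (Lx, \<epsilon>) = {(Lw, 0), (Lw, 1), (Ly, \<epsilon> + 1)}"
| "E24_succ (Lu, \<epsilon>) = {(Lu', \<epsilon>), (Lv', \<epsilon>)}"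
| "E24_succ (Lv, \<epsilon>) = {(Lu', \<epsilon>), (Lw', \<epsilon>)}"
| "E24_succ (Lw, \<epsilon>) = {(Lv', \<epsilon>), (Lw', 0), (Lw', 1), (Ly', \<epsilon> + 1)}"
| "E24_succ (Ly, \<epsilon>) = {(Lw', \<epsilon> + 1), (Ly', \<epsilon> + 1)}"
| "E24_succ (Lu', \<epsilon>) = {(Li, \<epsilon>), (La, \<epsilon>)}"
| "E24_succ (Lv', \<epsilon>) = {(La, \<epsilon>), (Lc, \<epsilon>)}"
| "E24_succ (Lw', \<epsilon>) = {(La, \<epsilon>), (Lc, \<epsilon> + 1), (Lx, 0), (Lx, 1)}"
| "E24_succ (Ly', \<epsilon>) = {(Lc, \<epsilon> + 1), (Lx, \<epsilon>)}"

definition E24 :: "(E24_vertex, E24_vertex \<times> E24_vertex) pre_digraph" where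
  "E24 = \<lparr>verts = UNIV, arcs = {(p, q). q \<in> E24_succ p}, tail = fst, head = snd\<rparr>"

definition E24_star :: E24_vertex where
  "E24_star = (Li, 0)"

end

theory Submission
  imports Defs
begin

text \<open>
  The vector $e_*$ is a sum of $24$ joint eigenvectors of $\Delta$ and $\Delta^*$, one for each
  eigenvalue $\lambda$, so that $\langle\Delta^m(\Delta^*)^n e_*,e_*\rangle=\sum_\lambda
  w_\lambda\lambda^m\overline\lambda^n$ with $w_\lambda$ the component at $*$ of the summand. The
  edges respect a $3$-colouring of the vertices, hence the spectrum is invariant under multiplication
  by $\omega$, and $\epsilon\mapsto\epsilon+1$ is an automorphism. Its invariant part contributes
  $\lambda=\omega^j(1+c)$ with $c^4=4c^2-1$, that is $c=2\cos(\pi t/12)$ for $t=1,5,7,11$; its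
  anti-invariant part contributes $\lambda=\omega^j(z^2+z^3)$ with $z^4=-1$.

  On $\mathbb{T}^2$ the function $R_{m,n}$ equals $\lambda^m\overline\lambda^n$ with $\lambda =
  \omega_1+\omega_2^{-1}+\omega_1^{-1}\omega_2$, which is constant on $S_3$-orbits. The six measures
  are supported on pairs of $24$-th roots of unity and consist of full orbits with six points, three
  or six orbits per measure; over these orbits $\lambda$ runs through the spectrum.
\<close>

section \<open>The graph\<close>

lemma mod2_cases: "(\<epsilon> :: 2) = 0 \<or> \<epsilon> = 1"
proof (cases \<epsilon>)
  case (of_int z)
  then have "z = 0 \<or> z = 1" by auto
  then show ?thesis using of_int by auto
qed

lemma mod2_numeral [simp]: "(2 :: 2) = 0" "(3 :: 2) = 1"
  by simp_all

text \<open>Together with \<open>forall_E24_label\<close>, this splits a claim about all vertices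
  into 24 concrete ones that rewriting can decide.\<close>

lemma forall_E24_vertex: "(\<forall>p :: E24_vertex. P p) \<longleftrightarrow> (\<forall>l. P (l, 0) \<and> P (l, 1))"
proof -
  have "(\<forall>p :: E24_vertex. P p) \<longleftrightarrow> (\<forall>l \<epsilon>. P (l, \<epsilon>))" by auto
  then show ?thesis using mod2_cases by metis
qed

lemma forall_E24_label: "(\<forall>l. P l) \<longleftrightarrow> P Li \<and> P La \<and> P Lc \<and> P Lx \<and> P Lu \<and> P Lv \<and> P Lw \<and> P Ly
    \<and> P Lu' \<and> P Lv' \<and> P Lw' \<and> P Ly'"
  by (rule iffI, simp, rule allI, rule E24_label.induct, simp_all)

text \<open>The in-neighbours are tabulated so that the adjoint can be evaluated by rewriting, as
  the adjacency matrix is; \<open>E24_pred_iff\<close> checks the table.\<close>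

fun E24_pred :: "E24_vertex \<Rightarrow> E24_vertex set" where
  "E24_pred (Li, \<epsilon>) = {(Lu', \<epsilon>)}"
| "E24_pred (La, \<epsilon>) = {(Lu', \<epsilon>), (Lv', \<epsilon>), (Lw', \<epsilon>)}"
| "E24_pred (Lc, \<epsilon>) = {(Lv', \<epsilon>), (Lw', \<epsilon> + 1), (Ly', \<epsilon> + 1)}"
| "E24_pred (Lx, \<epsilon>) = {(Lw', 0), (Lw', 1), (Ly', \<epsilon>)}"
| "E24_pred (Lu, \<epsilon>) = {(Li, \<epsilon>), (La, \<epsilon>)}"
| "E24_pred (Lv, \<epsilon>) = {(La, \<epsilon>), (Lc, \<epsilon> + 1)}"
| "E24_pred (Lw, \<epsilon>) = {(La, \<epsilon>), (Lc, \<epsilon>), (Lx, 0), (Lx, 1)}"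
| "E24_pred (Ly, \<epsilon>) = {(Lc, \<epsilon>), (Lx, \<epsilon> + 1)}"
| "E24_pred (Lu', \<epsilon>) = {(Lu, \<epsilon>), (Lv, \<epsilon>)}"
| "E24_pred (Lv', \<epsilon>) = {(Lu, \<epsilon>), (Lw, \<epsilon>)}"
| "E24_pred (Lw', \<epsilon>) = {(Lv, \<epsilon>), (Lw, 0), (Lw, 1), (Ly, \<epsilon> + 1)}"
| "E24_pred (Ly', \<epsilon>) = {(Lw, \<epsilon> + 1), (Ly, \<epsilon> + 1)}"

lemma E24_pred_iff: "p \<in> E24_pred q \<longleftrightarrow> q \<in> E24_succ p"
proof -
  have "\<forall>p q. p \<in> E24_pred q \<longleftrightarrow> q \<in> E24_succ p"
    unfolding forall_E24_vertex forall_E24_label by simp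
  then show ?thesis by blast
qed

lemma adjacency_E24: "adjacency E24 $ p $ q = (if q \<in> E24_succ p then 1 else 0)"
proof -
  have "{e \<in> arcs E24. tail E24 e = p \<and> head E24 e = q} = (if q \<in> E24_succ p then {(p, q)} else {})"
    by (auto simp: E24_def)
  then show ?thesis by (simp add: adjacency_def)
qed

lemma adjacency_E24_mult: "(adjacency E24 *v x) $ p = (\<Sum>q\<in>E24_succ p. x $ q)"
proof -
  have "(adjacency E24 *v x) $ p = (\<Sum>q\<in>UNIV. if q \<in> E24_succ p then x $ q else 0)"
    unfolding matrix_vector_mult_def adjacency_E24 by (simp, intro sum.cong) auto
  then show ?thesis by (simp add: sum.If_cases)
qed

lemma adjoint_E24_mult: "(adjoint_matrix (adjacency E24) *v x) $ p = (\<Sum>q\<in>E24_pred p. x $ q)"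
proof -
  have "(adjoint_matrix (adjacency E24) *v x) $ p = (\<Sum>q\<in>UNIV. if q \<in> E24_pred p then x $ q else 0)"
    unfolding matrix_vector_mult_def adjoint_matrix_def adjacency_E24 E24_pred_iff
    by (simp, intro sum.cong) auto
  then show ?thesis by (simp add: sum.If_cases)
qed

text \<open>Applied to an arbitrary \<open>x\<close>, the products sum \<open>x\<close> over
  in-neighbours of out-neighbours and over out-neighbours of in-neighbours; the sums agree at each
  vertex.\<close>

lemma E24_normal:
  "adjacency E24 ** adjoint_matrix (adjacency E24) = adjoint_matrix (adjacency E24) ** adjacency E24"
proof -
  have "\<forall>p. (adjacency E24 *v (adjoint_matrix (adjacency E24) *v x)) $ p
      = (adjoint_matrix (adjacency E24) *v (adjacency E24 *v x)) $ p" for x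
    unfolding forall_E24_vertex forall_E24_label adjacency_E24_mult adjoint_E24_mult
    by simp
  then show ?thesis
    by (simp add: matrix_eq vec_eq_iff flip: matrix_vector_mul_assoc)
qed

lemma E24_fin_digraph: "fin_digraph E24"
  by unfold_locales (auto simp: E24_def)

section \<open>Joint eigenvectors\<close>

lemma joint_eigenvectors_power:
  fixes A B :: "complex ^ 'n ^ 'n"
  assumes "finite J" "x = (\<Sum>j\<in>J. v j)"
    and A: "\<And>j. j \<in> J \<Longrightarrow> A *v v j = l j *s v j"
    and B: "\<And>j. j \<in> J \<Longrightarrow> B *v v j = \<mu> j *s v j"
  shows "((*v) A ^^ m) (((*v) B ^^ n) x) = (\<Sum>j\<in>J. (l j ^ m * \<mu> j ^ n) *s v j)"
proof -
  have sum: "M *v (\<Sum>j\<in>J. f j) = (\<Sum>j\<in>J. M *v f j)" for M :: "complex ^ 'n ^ 'n" and f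
    by (induction J rule: infinite_finite_induct) (simp_all add: matrix_vector_right_distrib)
  have 0: "((*v) B ^^ n) x = (\<Sum>j\<in>J. \<mu> j ^ n *s v j)"
    by (induction n)
      (simp_all add: assms(2) sum vector_scalar_commute B mult.commute)
  show ?thesis
    by (induction m) (simp_all add: 0 sum vector_scalar_commute A mult_ac)
qed

text \<open>Every edge raises the colour by 1 modulo 3.\<close>

fun vertex_colour :: "E24_label \<Rightarrow> nat" where
  "vertex_colour Li = 0" | "vertex_colour La = 0" | "vertex_colour Lc = 0" | "vertex_colour Lx = 0"
| "vertex_colour Lu = 1" | "vertex_colour Lv = 1" | "vertex_colour Lw = 1" | "vertex_colour Ly = 1"
| "vertex_colour Lu' = 2" | "vertex_colour Lv' = 2" | "vertex_colour Lw' = 2" | "vertex_colour Ly' = 2"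

text \<open>For \<open>\<eta>^3 = 1\<close> the factor \<open>\<eta> ^ vertex_colour l\<close>
  multiplies an eigenvalue by \<open>\<eta>\<close>; \<open>\<sigma>\<close> is 1 or -1 on the part
  invariant or anti-invariant under \<open>\<epsilon> + 1\<close>.\<close>

definition eigvec :: "complex \<Rightarrow> complex \<Rightarrow> (E24_label \<Rightarrow> complex) \<Rightarrow> complex ^ E24_vertex" where
  "eigvec \<eta> \<sigma> g = (\<chi> p. case p of (l, \<epsilon>) \<Rightarrow> \<eta> ^ vertex_colour l * (if \<epsilon> = 0 then 1 else \<sigma>) * g l)"

lemma eigvec_nth [simp]:
  "eigvec \<eta> \<sigma> g $ (l, 0) = \<eta> ^ vertex_colour l * g l"
  "eigvec \<eta> \<sigma> g $ (l, 1) = \<eta> ^ vertex_colour l * \<sigma> * g l"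
  by (auto simp: eigvec_def)

text \<open>The entries solve the eigenvector equations over $\mathbb{Q}(c)$ and $\mathbb{Q}(z)$; they are
  scaled so that, divided by $144$ and $48$, the eigenvectors add up to $e_*$.\<close>

fun sym_entry :: "complex \<Rightarrow> E24_label \<Rightarrow> complex" where
  "sym_entry c Li = 10 - 5 * c - 2 * c^2 + c^3"
| "sym_entry c La = 19 * c - 5 * c^3"
| "sym_entry c Lc = 4 - 9 * c - 2 * c^2 + 3 * c^3"
| "sym_entry c Lx = - 4 - 5 * c + 2 * c^2 + c^3"
| "sym_entry c Lu = 9 + 5 * c - 3 * c^2 - c^3"
| "sym_entry c Lv = 1 + 9 * c + c^2 - 3 * c^3"
| "sym_entry c Lw = - 5 + 5 * c + c^2 - c^3"
| "sym_entry c Ly = 5 - 19 * c - c^2 + 5 * c^3"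
| "sym_entry c Lu' = 9 + 5 * c - 3 * c^2 - c^3"
| "sym_entry c Lv' = 1 + 9 * c + c^2 - 3 * c^3"
| "sym_entry c Lw' = - 5 + 5 * c + c^2 - c^3"
| "sym_entry c Ly' = 5 - 19 * c - c^2 + 5 * c^3"

fun antisym_entry :: "complex \<Rightarrow> E24_label \<Rightarrow> complex" where
  "antisym_entry z Li = 2 - z + z^3"
| "antisym_entry z La = z - z^3"
| "antisym_entry z Lc = - z - z^3"
| "antisym_entry z Lx = - z + 2 * z^2 - z^3"
| "antisym_entry z Lu = 1 - z + z^2 + z^3"
| "antisym_entry z Lv = - 1 + z - z^2 + z^3"
| "antisym_entry z Lw = - 1 + z + z^2 - z^3"
| "antisym_entry z Ly = 1 + z - z^2 + z^3"
| "antisym_entry z Lu' = 1 - z - z^2 + z^3"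
| "antisym_entry z Lv' = - 1 - z + z^2 - z^3"
| "antisym_entry z Lw' = - 1 + z - z^2 - z^3"
| "antisym_entry z Ly' = 1 - z + z^2 - z^3"

text \<open>The 24 coordinates are polynomial identities modulo the two assumptions. The adjoint has
  the conjugate eigenvalue, because \<open>c\<close> will be real and \<open>\<eta>^2\<close> is the
  conjugate of \<open>\<eta>\<close>.\<close>

lemma eigvec_sym:
  assumes "c^4 = 4 * c^2 - 1" "\<eta>^3 = 1"
  shows "adjacency E24 *v eigvec \<eta> 1 (sym_entry c) = (\<eta> * (1 + c)) *s eigvec \<eta> 1 (sym_entry c)"
    and "adjoint_matrix (adjacency E24) *v eigvec \<eta> 1 (sym_entry c)
      = (\<eta>^2 * (1 + c)) *s eigvec \<eta> 1 (sym_entry c)"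
  unfolding vec_eq_iff forall_E24_vertex forall_E24_label adjacency_E24_mult adjoint_E24_mult
  using assms by (simp_all, algebra+)

text \<open>From \<open>z^4 = - 1\<close> the conjugates of \<open>z^2\<close> and
  \<open>z^3\<close> are \<open>- z^2\<close> and \<open>- z\<close>, so the second eigenvalue is
  again the conjugate of the first.\<close>

lemma eigvec_antisym:
  assumes "z^4 = - 1" "\<eta>^3 = 1"
  shows "adjacency E24 *v eigvec \<eta> (- 1) (antisym_entry z)
      = (\<eta> * (z^2 + z^3)) *s eigvec \<eta> (- 1) (antisym_entry z)"
    and "adjoint_matrix (adjacency E24) *v eigvec \<eta> (- 1) (antisym_entry z)
      = (\<eta>^2 * (- z - z^2)) *s eigvec \<eta> (- 1) (antisym_entry z)"
  unfolding vec_eq_iff forall_E24_vertex forall_E24_label adjacency_E24_mult adjoint_E24_mult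
  using assms by (simp_all, algebra+)

text \<open>Odd powers cancel in pairs of opposite sign, and the squares add up to
  \<open>2 * (c^2 + d^2) = 8\<close>.\<close>

lemma sum_sym_entry:
  assumes "d^2 = 4 - c^2" "vertex_colour l = 0"
  shows "(\<Sum>x\<leftarrow>[c, d, - d, - c]. sym_entry x l) = (if l = Li then 24 else 0)"
  using assms by (cases l; simp; algebra?)

text \<open>The list consists of the fourth roots of -1: odd powers cancel by sign, squares because
  \<open>z^6 = - z^2\<close>.\<close>

lemma sum_antisym_entry:
  assumes "z^4 = - 1" "vertex_colour l = 0"
  shows "(\<Sum>x\<leftarrow>[z, z ^ 3, - z, - (z ^ 3)]. antisym_entry x l) = (if l = Li then 8 else 0)"
proof -
  have "z\<^sup>2 + (z ^ 3)\<^sup>2 = 0" using assms(1) by algebra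
  then have "(z ^ 3)\<^sup>2 = - z\<^sup>2" by (simp add: eq_neg_iff_add_eq_0 add.commute)
  then show ?thesis
    using assms(2) by (cases l) (simp_all add: algebra_simps)
qed

text \<open>Summing over the cube roots of unity annihilates colours 1 and 2.\<close>

lemma sum_cube_root_powers:
  fixes \<eta> :: complex
  assumes "\<eta>^2 + \<eta> + 1 = 0"
  shows "(\<Sum>i\<in>{0, 1, 2::nat}. (\<eta> ^ i) ^ vertex_colour l) = (if vertex_colour l = 0 then 3 else 0)"
proof -
  have "1 + (\<eta> + \<eta>^2) = 0" "1 + (\<eta>^2 + (\<eta>^2)^2) = 0"
    using assms by algebra+
  then show ?thesis
    by (cases l) (simp_all add: algebra_simps)
qed

text \<open>The sum over \<open>i\<close> leaves colour 0, and there the sums over the roots leave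
  only \<open>Li\<close>. Its entries are \<open>3 * (24 / 144 + 8 / 48) = 1\<close> at
  \<open>\<epsilon> = 0\<close> and \<open>3 * (24 / 144 - 8 / 48) = 0\<close> at
  \<open>\<epsilon> = 1\<close>.\<close>

lemma E24_star_decomposition:
  assumes "\<eta>^2 + \<eta> + 1 = 0" "d^2 = 4 - c^2" "z^4 = - 1"
  shows "axis E24_star 1 = (\<Sum>i\<in>{0, 1, 2::nat}.
      (1 / 144) *s (\<Sum>x\<leftarrow>[c, d, - d, - c]. eigvec (\<eta> ^ i) 1 (sym_entry x))
      + (1 / 48) *s (\<Sum>x\<leftarrow>[z, z ^ 3, - z, - (z ^ 3)]. eigvec (\<eta> ^ i) (- 1) (antisym_entry x)))"
    (is "_ = ?v")
proof -
  define P where "P l = (\<Sum>x\<leftarrow>[c, d, - d, - c]. sym_entry x l)" for l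
  define M where "M l = (\<Sum>x\<leftarrow>[z, z ^ 3, - z, - (z ^ 3)]. antisym_entry x l)" for l
  have nth: "?v $ (l, 0) = (\<Sum>i\<in>{0, 1, 2}. (\<eta> ^ i) ^ vertex_colour l) * (P l / 144 + M l / 48)"
    "?v $ (l, 1) = (\<Sum>i\<in>{0, 1, 2}. (\<eta> ^ i) ^ vertex_colour l) * (P l / 144 - M l / 48)" for l
    by (simp_all add: P_def M_def field_simps)
  have "P l = (if l = Li then 24 else 0)" "M l = (if l = Li then 8 else 0)" if "vertex_colour l = 0" for l
    unfolding P_def M_def
    by (rule sum_sym_entry[OF assms(2) that], rule sum_antisym_entry[OF assms(3) that])
  then have "?v $ (l, 0) = (if l = Li then 1 else 0)" "?v $ (l, 1) = 0" for l
    unfolding nth sum_cube_root_powers[OF assms(1)] by auto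
  then show ?thesis
    unfolding vec_eq_iff forall_E24_vertex by (auto simp: axis_def E24_star_def)
qed

section \<open>Twenty-fourth roots of unity\<close>

definition root24 :: "int \<Rightarrow> complex" where
  "root24 k = cis (pi / 12 * of_int k)"

lemma root24_0 [simp]: "root24 0 = 1"
  by (simp add: root24_def)

lemma root24_add: "root24 (j + k) = root24 j * root24 k"
  by (simp add: root24_def cis_mult distrib_left)

lemma cnj_root24: "cnj (root24 k) = root24 (- k)"
  by (simp add: root24_def cis_cnj)

lemma inverse_root24: "inverse (root24 k) = root24 (- k)"
  by (simp add: root24_def)

lemma norm_root24 [simp]: "norm (root24 k) = 1"
  by (simp add: root24_def)

lemma root24_of_nat: "root24 (int n) = root24 1 ^ n"
  by (simp add: root24_def Complex.DeMoivre mult.commute)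

lemma root24_power: "root24 k ^ n = root24 (int n * k)"
  by (simp add: root24_def Complex.DeMoivre mult_ac)

lemma root24_12 [simp]: "root24 12 = - 1"
  by (simp add: root24_def)

lemma minus_root24: "- root24 k = root24 (12 + k)"
  by (simp add: root24_add)

lemma root24_eq_1_iff: "root24 k = 1 \<longleftrightarrow> 24 dvd k"
proof
  assume "root24 k = 1"
  then have "cos (pi / 12 * of_int k) = 1" by (simp add: root24_def complex_eq_iff)
  then obtain n :: int where "pi / 12 * of_int k = n * 2 * pi" by (auto simp: cos_one_2pi_int)
  then have "real_of_int k = real_of_int (24 * n)" by (simp add: field_simps)
  then show "24 dvd k" by (metis dvd_triv_left of_int_eq_iff)
next
  assume "24 dvd k"
  then obtain n where "k = 24 * n" by auto
  then have "pi / 12 * of_int k = of_int n * 2 * pi" by simp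
  then show "root24 k = 1"
    by (metis root24_def cis_multiple_2pi Ints_of_int mult.assoc mult.commute)
qed

lemma root24_eq_iff: "root24 j = root24 k \<longleftrightarrow> j mod 24 = k mod 24"
proof -
  have "root24 (j - k) * root24 k = root24 j" by (simp flip: root24_add)
  moreover have "root24 k \<noteq> 0" using norm_root24[of k] by fastforce
  ultimately have "root24 j = root24 k \<longleftrightarrow> root24 (j - k) = 1" by auto
  then show ?thesis by (simp add: root24_eq_1_iff mod_eq_dvd_iff)
qed

lemma root24_eq_power: "root24 k = root24 1 ^ nat (k mod 24)"
proof -
  have "root24 k = root24 (int (nat (k mod 24)))" by (simp add: root24_eq_iff)
  then show ?thesis by (simp only: root24_of_nat)
qed

text \<open>This is the cyclotomic polynomial of order 24: \<open>root24 1 ^ 4\<close> is a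
  primitive sixth root of unity, a root of \<open>y^2 - y + 1\<close>.\<close>

lemma root24_min_poly: "root24 1 ^ 8 = root24 1 ^ 4 - 1"
proof -
  have "root24 1 ^ 4 = cis (pi / 3)" using root24_of_nat[of 4] by (simp add: root24_def)
  moreover have "cis (pi / 3) ^ 2 = cis (pi / 3) - 1"
    by (simp add: complex_eq_iff power2_eq_square cos_60 sin_60 cis.code)
  ultimately show ?thesis by (metis power_mult_numeral num_double numeral_times_numeral)
qed

text \<open>A normal form: all powers are expressed in the basis
  \<open>1, \<zeta>, ..., \<zeta>^7\<close> of the cyclotomic field.\<close>

lemma root24_powers:
  defines "\<zeta> \<equiv> root24 1"
  shows "\<zeta> ^ 8 = \<zeta> ^ 4 - 1" "\<zeta> ^ 9 = \<zeta> ^ 5 - \<zeta>" "\<zeta> ^ 10 = \<zeta> ^ 6 - \<zeta> ^ 2" "\<zeta> ^ 11 = \<zeta> ^ 7 - \<zeta> ^ 3"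
    "\<zeta> ^ 12 = - 1" "\<zeta> ^ 13 = - \<zeta>" "\<zeta> ^ 14 = - (\<zeta> ^ 2)" "\<zeta> ^ 15 = - (\<zeta> ^ 3)" "\<zeta> ^ 16 = - (\<zeta> ^ 4)"
    "\<zeta> ^ 17 = - (\<zeta> ^ 5)" "\<zeta> ^ 18 = - (\<zeta> ^ 6)" "\<zeta> ^ 19 = - (\<zeta> ^ 7)" "\<zeta> ^ 20 = 1 - \<zeta> ^ 4"
    "\<zeta> ^ 21 = \<zeta> - \<zeta> ^ 5" "\<zeta> ^ 22 = \<zeta> ^ 2 - \<zeta> ^ 6" "\<zeta> ^ 23 = \<zeta> ^ 3 - \<zeta> ^ 7"
  using root24_min_poly unfolding \<zeta>_def[symmetric] by - algebra+

text \<open>The instances leave out \<open>root24 1\<close>, on which the rule would loop;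
  \<open>- 1\<close> is not a negated numeral and needs its own instance.\<close>

lemmas root24_reduce = root24_eq_power[of "numeral k" for k] root24_eq_power[of "- numeral k" for k]
  root24_eq_power[of "- 1"] root24_powers

lemma root24_3_power4: "root24 3 ^ 4 = - 1"
proof -
  have "root24 3 = root24 1 ^ 3" by (simp add: root24_reduce)
  then show ?thesis using root24_min_poly by algebra
qed

lemma sum_root24_min_poly:
  assumes "t \<in> {1, 5, 7, 11}"
  shows "(root24 t + root24 (- t)) ^ 4 = 4 * (root24 t + root24 (- t)) ^ 2 - 1"
proof -
  define z where "z = root24 1"
  then have z: "z ^ 8 = z ^ 4 - 1" by (simp only: root24_min_poly)
  \<comment> \<open>The bases are \<open>root24 t + root24 (- t)\<close> for \<open>t\<close> = 1,
    5, 7, 11 in normal form.\<close>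
  have "(z + (z ^ 3 - z ^ 7)) ^ 4 = 4 * (z + (z ^ 3 - z ^ 7)) ^ 2 - 1"
    "(z ^ 5 - z ^ 7) ^ 4 = 4 * (z ^ 5 - z ^ 7) ^ 2 - 1"
    "(z ^ 7 - z ^ 5) ^ 4 = 4 * (z ^ 7 - z ^ 5) ^ 2 - 1"
    "(z ^ 7 - z ^ 3 - z) ^ 4 = 4 * (z ^ 7 - z ^ 3 - z) ^ 2 - 1"
    using z by algebra+
  then show ?thesis
    using assms by (auto simp: root24_reduce z_def)
qed

text \<open>Twice the cosines of 45 and 30 degrees, and their product. This moves the coefficients
  of the measure into the cyclotomic field of the weights.\<close>

lemma sqrt_root24:
  "complex_of_real (sqrt 2) = root24 3 + root24 (- 3)"
  "complex_of_real (sqrt 3) = root24 2 + root24 (- 2)"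
  "complex_of_real (sqrt 6) = root24 1 + root24 (- 1) + root24 5 + root24 (- 5)"
proof -
  show 2: "complex_of_real (sqrt 2) = root24 3 + root24 (- 3)"
    by (simp add: root24_def complex_eq_iff cos_45)
  show 3: "complex_of_real (sqrt 3) = root24 2 + root24 (- 2)"
    by (simp add: root24_def complex_eq_iff cos_30)
  have "complex_of_real (sqrt 6) = complex_of_real (sqrt 2) * complex_of_real (sqrt 3)"
    by (simp flip: of_real_mult real_sqrt_mult)
  then show "complex_of_real (sqrt 6) = root24 1 + root24 (- 1) + root24 5 + root24 (- 5)"
    by (simp add: 2 3 algebra_simps flip: root24_add)
qed

section \<open>Moments of the graph\<close>

text \<open>An exponent \<open>t\<close> prime to \<open>3\<close> stands for $c=\zeta^t+\zeta^{-t}$, a multiple of \<open>3\<close> for $z=\zeta^t$,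
  where $\zeta=e^{2\pi i/24}$.\<close>

definition E24_exponents :: "int set" where
  "E24_exponents = {1, 5, 7, 11, 3, 9, 15, 21}"

definition E24_eigenvalue :: "int \<Rightarrow> complex" where
  "E24_eigenvalue t = (if 3 dvd t then root24 (2 * t) + root24 (3 * t) else 1 + root24 t + root24 (- t))"

definition E24_eigenvector :: "nat \<Rightarrow> int \<Rightarrow> complex ^ E24_vertex" where
  "E24_eigenvector i t = (if 3 dvd t
     then (1 / 48) *s eigvec (root24 8 ^ i) (- 1) (antisym_entry (root24 t))
     else (1 / 144) *s eigvec (root24 8 ^ i) 1 (sym_entry (root24 t + root24 (- t))))"

definition E24_weight :: "int \<Rightarrow> complex" where
  "E24_weight t = (if 3 dvd t then antisym_entry (root24 t) Li / 48
     else sym_entry (root24 t + root24 (- t)) Li / 144)"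

text \<open>No dependence on \<open>i\<close> remains, since the distinguished vertex has colour
  0.\<close>

lemma E24_eigenvector_star: "E24_eigenvector i t $ E24_star = E24_weight t"
  by (simp add: E24_eigenvector_def E24_weight_def E24_star_def)

lemma matrix_vector_scale_eigenvector:
  fixes A :: "complex ^ 'n ^ 'n"
  shows "A *v v = l *s v \<Longrightarrow> A *v (k *s v) = l *s (k *s v)"
  by (simp add: vector_scalar_commute mult.commute)

lemma E24_eigenvector_mult:
  assumes "t \<in> E24_exponents"
  shows "adjacency E24 *v E24_eigenvector i t
      = (root24 8 ^ i * E24_eigenvalue t) *s E24_eigenvector i t"
    and "adjoint_matrix (adjacency E24) *v E24_eigenvector i t
      = cnj (root24 8 ^ i * E24_eigenvalue t) *s E24_eigenvector i t"
proof -
  define \<eta> where "\<eta> = root24 8 ^ i"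
  have "24 dvd int 3 * (int i * 8)" by (simp add: algebra_simps)
  then have \<eta>3: "\<eta> ^ 3 = 1" unfolding \<eta>_def root24_power by (simp only: root24_eq_1_iff)
  have cnj_\<eta>: "cnj \<eta> = \<eta> ^ 2"
    unfolding \<eta>_def root24_power cnj_root24 root24_eq_iff by (simp add: mod_eq_dvd_iff algebra_simps)
  have "adjacency E24 *v E24_eigenvector i t = (\<eta> * E24_eigenvalue t) *s E24_eigenvector i t
    \<and> adjoint_matrix (adjacency E24) *v E24_eigenvector i t
      = (\<eta> ^ 2 * cnj (E24_eigenvalue t)) *s E24_eigenvector i t"
  proof (cases "3 dvd t")
    case True
    define z where "z = root24 t"
    have t: "t \<in> {3, 9, 15, 21}" using assms True by (auto simp: E24_exponents_def)
    \<comment> \<open>As \<open>t\<close> is an odd multiple of 3, \<open>4 * t\<close> is 12 modulo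
      24.\<close>
    have "z ^ 4 = root24 12"
      using t unfolding z_def root24_power root24_eq_iff by auto
    then have z4: "z ^ 4 = - 1" by simp
    have ev: "E24_eigenvalue t = z ^ 2 + z ^ 3"
      using True by (simp add: E24_eigenvalue_def z_def root24_power)
    have "root24 (- (2 * t)) = - (z ^ 2)" "root24 (- (3 * t)) = - z"
      using t unfolding z_def root24_power minus_root24 root24_eq_iff by auto
    then have cnj_ev: "cnj (E24_eigenvalue t) = - z - z ^ 2"
      using True by (simp add: E24_eigenvalue_def cnj_root24)
    have vec: "E24_eigenvector i t = (1 / 48) *s eigvec \<eta> (- 1) (antisym_entry z)"
      using True by (simp add: E24_eigenvector_def \<eta>_def z_def)
    show ?thesis
      \<comment> \<open>The conjugate must be rewritten first, since \<open>ev\<close> would also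
        replace the eigenvalue inside \<open>cnj\<close>.\<close>
      unfolding vec cnj_ev unfolding ev
      by (intro conjI matrix_vector_scale_eigenvector eigvec_antisym z4 \<eta>3)
  next
    case False
    define c where "c = root24 t + root24 (- t)"
    have c4: "c ^ 4 = 4 * c ^ 2 - 1"
      unfolding c_def using assms False by (intro sum_root24_min_poly) (auto simp: E24_exponents_def)
    have ev: "E24_eigenvalue t = 1 + c"
      using False by (simp add: E24_eigenvalue_def c_def)
    have cnj_ev: "cnj (E24_eigenvalue t) = 1 + c"
      by (simp add: ev c_def cnj_root24)
    have vec: "E24_eigenvector i t = (1 / 144) *s eigvec \<eta> 1 (sym_entry c)"
      using False by (simp add: E24_eigenvector_def \<eta>_def c_def)
    show ?thesis
      unfolding vec cnj_ev unfolding ev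
      by (intro conjI matrix_vector_scale_eigenvector eigvec_sym c4 \<eta>3)
  qed
  then show "adjacency E24 *v E24_eigenvector i t
      = (root24 8 ^ i * E24_eigenvalue t) *s E24_eigenvector i t"
    and "adjoint_matrix (adjacency E24) *v E24_eigenvector i t
      = cnj (root24 8 ^ i * E24_eigenvalue t) *s E24_eigenvector i t"
    unfolding \<eta>_def[symmetric] complex_cnj_mult cnj_\<eta> by simp_all
qed

text \<open>The decomposition at \<open>c\<close>, \<open>d\<close>, \<open>- d\<close>,
  \<open>- c\<close> gives the exponents 1, 5, 7, 11, and at \<open>z\<close>, \<open>z ^ 3\<close>,
  \<open>- z\<close>, \<open>- (z ^ 3)\<close> the exponents 3, 9, 15, 21.\<close>

lemma sum_E24_eigenvectors:
  "axis E24_star 1 = (\<Sum>i\<in>{0, 1, 2}. \<Sum>t\<in>E24_exponents. E24_eigenvector i t)"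
proof -
  define c d z where "c = root24 1 + root24 (- 1)" and "d = root24 5 + root24 (- 5)" and "z = root24 3"
  have \<eta>: "root24 8 ^ 2 + root24 8 + 1 = 0"
    by (simp add: root24_power) (simp add: root24_reduce)
  have "c ^ 2 = root24 2 + 2 + root24 (- 2)" "d ^ 2 = root24 10 + 2 + root24 (- 10)"
    by (simp_all add: c_def d_def power2_eq_square algebra_simps flip: root24_add)
  \<comment> \<open>\<open>root24 10\<close> cancels \<open>root24 (- 2)\<close> and
    \<open>root24 (- 10)\<close> cancels \<open>root24 2\<close>, since
    \<open>root24 12 = - 1\<close>.\<close>
  then have cd: "d ^ 2 = 4 - c ^ 2"
    by (simp add: root24_reduce)
  have "- d = root24 7 + root24 (- 7)" "- c = root24 11 + root24 (- 11)"
    by (simp_all add: root24_reduce c_def d_def)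
  moreover have "z ^ 3 = root24 9" "- z = root24 15" "- (z ^ 3) = root24 21"
    by (simp_all add: z_def root24_power minus_root24)
  ultimately show ?thesis
    unfolding E24_star_decomposition[OF \<eta> cd root24_3_power4[folded z_def]]
    by (intro sum.cong) (simp_all add: E24_exponents_def E24_eigenvector_def c_def d_def z_def
        vector_add_ldistrib)
qed

lemma E24_moments:
  "hinner (((*v) (adjacency E24) ^^ m) (((*v) (adjoint_matrix (adjacency E24)) ^^ n) (axis E24_star 1)))
      (axis E24_star 1)
    = (\<Sum>i\<in>{0, 1, 2}. \<Sum>t\<in>E24_exponents. E24_weight t *
        ((root24 8 ^ i * E24_eigenvalue t) ^ m * cnj (root24 8 ^ i * E24_eigenvalue t) ^ n))"
proof -
  let ?J = "{0, 1, 2::nat} \<times> E24_exponents"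
  let ?l = "\<lambda>(i, t). root24 8 ^ i * E24_eigenvalue t"
  let ?v = "\<lambda>(i, t). E24_eigenvector i t"
  have fin: "finite ?J" by (simp add: E24_exponents_def)
  have dec: "axis E24_star 1 = sum ?v ?J"
    by (simp only: sum_E24_eigenvectors sum.cartesian_product)
  have hinner: "hinner x (axis E24_star 1) = x $ E24_star" for x
    by (simp add: hinner_def axis_def if_distrib[of cnj] if_distrib[of "\<lambda>x. _ * x"] cong: if_cong)
  have "((*v) (adjacency E24) ^^ m) (((*v) (adjoint_matrix (adjacency E24)) ^^ n) (axis E24_star 1))
      = (\<Sum>j\<in>?J. (?l j ^ m * cnj (?l j) ^ n) *s ?v j)"
    by (rule joint_eigenvectors_power[OF fin dec]) (auto simp: E24_eigenvector_mult)
  then show ?thesis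
    by (simp add: hinner case_prod_unfold E24_eigenvector_star mult.commute sum.cartesian_product
        del: sum.insert)
qed

section \<open>The orbits of the torus\<close>

text \<open>The three rotations of the point come first, then its three reflections.\<close>

fun S3_images :: "complex \<times> complex \<Rightarrow> (complex \<times> complex) set" where
  "S3_images (a, b) = {(a, b), (inverse b, a * inverse b), (inverse a * b, inverse a),
     (inverse b, inverse a), (inverse a * b, b), (a, a * inverse b)}"

definition torus_refl :: "complex \<times> complex \<Rightarrow> complex \<times> complex" where
  "torus_refl = (\<lambda>(w1, w2) \<in> torus. (inverse w2, inverse w1))"

definition torus_rot :: "complex \<times> complex \<Rightarrow> complex \<times> complex" where
  "torus_rot = (\<lambda>(w1, w2) \<in> torus. (inverse w2, w1 * inverse w2))"

lemma mem_torus_iff: "(a, b) \<in> torus \<longleftrightarrow> norm a = 1 \<and> norm b = 1"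
  by (simp add: torus_def)

lemma torus_nonzero: "(a, b) \<in> torus \<Longrightarrow> a \<noteq> 0 \<and> b \<noteq> 0"
  by (auto simp: mem_torus_iff)

lemma torus_refl_apply: "(a, b) \<in> torus \<Longrightarrow> torus_refl (a, b) = (inverse b, inverse a)"
  by (simp add: torus_refl_def)

lemma torus_rot_apply: "(a, b) \<in> torus \<Longrightarrow> torus_rot (a, b) = (inverse b, a * inverse b)"
  by (simp add: torus_rot_def)

lemma torus_refl_Bij: "torus_refl \<in> Bij torus"
  unfolding Bij_def
proof (intro IntI CollectI)
  show "bij_betw torus_refl torus torus"
    by (rule bij_betw_byWitness[where f' = torus_refl])
      (auto simp: torus_refl_apply mem_torus_iff norm_inverse)
qed (simp add: torus_refl_def)

text \<open>The rotation has order three, so its square is the inverse.\<close>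

lemma torus_rot_Bij: "torus_rot \<in> Bij torus"
  unfolding Bij_def
proof (intro IntI CollectI)
  have mem: "torus_rot p \<in> torus" if "p \<in> torus" for p
    using that by (cases p) (simp add: torus_rot_apply, simp add: mem_torus_iff norm_inverse norm_mult)
  have "torus_rot (torus_rot (torus_rot p)) = p" if "p \<in> torus" for p
  proof -
    obtain a b where p: "p = (a, b)" by force
    show ?thesis
      using that torus_nonzero[of a b] unfolding p
      by (simp add: torus_rot_apply mem_torus_iff norm_inverse norm_mult) (simp add: field_simps)
  qed
  then show "bij_betw torus_rot torus torus"
    by (intro bij_betw_byWitness[where f' = "\<lambda>p. torus_rot (torus_rot p)"])
      (simp_all add: image_subset_iff mem)
qed (simp add: torus_rot_def)

text \<open>With \<open>S3_images_sym\<close>, this gives the closure under products and inverses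
  that the induction over the generated group needs.\<close>

lemma S3_images_trans:
  "p \<in> torus \<Longrightarrow> q \<in> S3_images p \<Longrightarrow> r \<in> S3_images q \<Longrightarrow> r \<in> S3_images p"
  by (cases p) (auto simp: field_simps dest!: torus_nonzero)

lemma S3_images_sym: "p \<in> torus \<Longrightarrow> q \<in> S3_images p \<Longrightarrow> p \<in> S3_images q"
  by (cases p) (auto simp: field_simps dest!: torus_nonzero)

text \<open>\<open>subgroup_generated\<close> intersects the generators with the carrier, so both
  must first be known to be bijections.\<close>

lemma carrier_S3: "carrier S3 = generate (BijGroup torus) {torus_refl, torus_rot}"
proof -
  have "carrier (BijGroup torus) \<inter> {torus_refl, torus_rot} = {torus_refl, torus_rot}"
    using torus_refl_Bij torus_rot_Bij by (auto simp: BijGroup_def)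
  then show ?thesis
    by (simp add: S3_def carrier_subgroup_generated flip: torus_refl_def torus_rot_def)
qed

text \<open>By induction every group element sends a point to one of its six images; conversely,
  words of length at most two in the generators reach all six.\<close>

lemma S3_orbit_eq:
  assumes "p \<in> torus"
  shows "S3_orbit p = S3_images p"
proof
  have gen: "g \<in> Bij torus \<and> (\<forall>p\<in>torus. g p \<in> S3_images p)" if "g \<in> {torus_refl, torus_rot}" for g
    using that torus_refl_Bij torus_rot_Bij by (auto simp: torus_refl_apply torus_rot_apply)
  have "g \<in> Bij torus \<and> (\<forall>p\<in>torus. g p \<in> S3_images p)"
    if "g \<in> generate (BijGroup torus) {torus_refl, torus_rot}" for g
    using that
  proof (induction rule: generate.induct)
    case one
    have "\<one>\<^bsub>BijGroup torus\<^esub> \<in> Bij torus"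
      unfolding BijGroup_def monoid.simps by (rule id_Bij)
    moreover have "\<one>\<^bsub>BijGroup torus\<^esub> p = p" if "p \<in> torus" for p
      using that by (simp add: BijGroup_def)
    moreover have "p \<in> S3_images p" for p by (cases p) simp
    ultimately show ?case by simp
  next
    case (incl h)
    then show ?case by (rule gen)
  next
    case (inv h)
    have h: "h \<in> Bij torus" "\<And>p. p \<in> torus \<Longrightarrow> h p \<in> S3_images p" using gen[OF inv] by auto
    have "inv_into torus h q \<in> S3_images q" if q: "q \<in> torus" for q
    proof -
      have "q \<in> h ` torus" using h(1) q by (simp add: Bij_def bij_betw_def)
      then have "h (inv_into torus h q) = q" by (rule f_inv_into_f)
      with Bij_inv_into_mem[OF h(1) q] h(2) S3_images_sym show ?thesis by metis
    qed
    then show ?case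
      unfolding inv_BijGroup[OF h(1)] by (intro conjI restrict_inv_into_Bij h(1)) simp
  next
    case (eng g h)
    then have Bij: "g \<in> Bij torus" "h \<in> Bij torus" by simp_all
    then have mult: "g \<otimes>\<^bsub>BijGroup torus\<^esub> h = compose torus g h" by (simp add: BijGroup_def)
    have "g (h p) \<in> S3_images p" if p: "p \<in> torus" for p
    proof (rule S3_images_trans[OF p])
      have "h p \<in> torus" using Bij_imp_funcset[OF Bij(2)] p by blast
      then show "g (h p) \<in> S3_images (h p)" using eng.IH(1) by blast
      show "h p \<in> S3_images p" using eng.IH(2) p by blast
    qed
    then show ?case
      unfolding mult using compose_Bij[OF Bij] by (simp add: compose_eq)
  qed
  then show "S3_orbit p \<subseteq> S3_images p"
    using assms by (auto simp: S3_orbit_def orbit_def carrier_S3)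
next
  obtain a b where p: "p = (a, b)" by force
  have nz: "a \<noteq> 0" "b \<noteq> 0" using torus_nonzero assms p by auto
  have rot: "torus_rot p = (inverse b, a * inverse b)"
    using assms by (simp add: p torus_rot_apply)
  have refl: "torus_refl p = (inverse b, inverse a)"
    using assms by (simp add: p torus_refl_apply)
  have mem: "(inverse b, a * inverse b) \<in> torus" "(inverse b, inverse a) \<in> torus"
    using assms by (simp_all add: p mem_torus_iff norm_inverse norm_mult)
  have img: "g p \<in> S3_orbit p" if "g \<in> generate (BijGroup torus) {torus_refl, torus_rot}" for g
    using that by (auto simp: S3_orbit_def orbit_def carrier_S3)
  have comp: "g (h p) \<in> S3_orbit p" if "g \<in> {torus_refl, torus_rot}" "h \<in> {torus_refl, torus_rot}" for g h
  proof -
    have "g \<otimes>\<^bsub>BijGroup torus\<^esub> h = compose torus g h"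
      using that torus_refl_Bij torus_rot_Bij by (auto simp: BijGroup_def)
    then show ?thesis
      using img[OF generate.eng[OF generate.incl[OF that(1)] generate.incl[OF that(2)]]] assms
      by (simp add: compose_eq)
  qed
  have "p \<in> S3_orbit p"
    using img[OF generate.one] assms by (simp add: BijGroup_def)
  moreover have "torus_rot p \<in> S3_orbit p" "torus_refl p \<in> S3_orbit p"
    by (auto intro!: img generate.incl)
  moreover have "torus_rot (torus_rot p) = (inverse a * b, inverse a)"
    "torus_refl (torus_rot p) = (inverse a * b, b)"
    "torus_rot (torus_refl p) = (a, a * inverse b)"
    using mem nz by (simp_all add: rot refl torus_rot_apply torus_refl_apply field_simps)
  ultimately show "S3_images p \<subseteq> S3_orbit p"
    using comp[of torus_rot torus_rot] comp[of torus_refl torus_rot] comp[of torus_rot torus_refl]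
    by (simp add: rot refl) (simp add: p)
qed

section \<open>Discrete measures on the torus\<close>

text \<open>The first factor on the left is the density of a combination of uniform measures. The
  lemma serves twice: with \<open>g\<close> an indicator for measures of sets, and with
  \<open>g\<close> the integrand.\<close>

lemma sum_weighted_indicators:
  fixes g :: "'a \<Rightarrow> 'b::real_vector"
  assumes "finite P" "\<And>c F. (c, F) \<in> set cs \<Longrightarrow> F \<subseteq> P"
  shows "(\<Sum>p\<in>P. (\<Sum>(c, F)\<leftarrow>cs. c / card F * indicator F p) *\<^sub>R g p)
    = (\<Sum>(c, F)\<leftarrow>cs. (c / card F) *\<^sub>R (\<Sum>p\<in>F. g p))"
  using assms(2)
proof (induction cs)
  case (Cons x cs)
  obtain c F where x: "x = (c, F)" by force
  then have "F \<subseteq> P" using Cons.prems by auto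
  have "(\<Sum>p\<in>P. indicator F p *\<^sub>R g p) = (\<Sum>p\<in>P. if p \<in> F then g p else 0)"
    by (intro sum.cong) (auto simp: indicator_def)
  also have "\<dots> = (\<Sum>p\<in>F. g p)"
    using assms(1) \<open>F \<subseteq> P\<close> by (simp add: Int_absorb1 flip: sum.inter_restrict)
  finally have "(\<Sum>p\<in>P. indicator F p *\<^sub>R g p) = (\<Sum>p\<in>F. g p)" .
  then have "(\<Sum>p\<in>P. (c / card F * indicator F p) *\<^sub>R g p) = (c / card F) *\<^sub>R (\<Sum>p\<in>F. g p)"
    by (simp only: flip: scaleR_scaleR scaleR_sum_right)
  moreover have "(\<Sum>p\<in>P. (\<Sum>(c, F)\<leftarrow>cs. c / card F * indicator F p) *\<^sub>R g p)
    = (\<Sum>(c, F)\<leftarrow>cs. (c / card F) *\<^sub>R (\<Sum>p\<in>F. g p))"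
    by (rule Cons.IH) (use Cons.prems in auto)
  ultimately show ?case
    by (simp add: x scaleR_add_left sum.distrib)
qed simp

lemma space_torus_borel: "space torus_borel = torus"
  by (simp add: torus_borel_def space_restrict_space)

lemma emeasure_uniform_on:
  assumes "finite F" "F \<subseteq> torus" "A \<in> sets torus_borel"
  shows "emeasure (uniform_on F) A = ennreal (card (F \<inter> A) / card F)"
proof -
  have "(\<lambda>p. p) \<in> measurable (uniform_count_measure F) torus_borel"
    using assms(2) by (auto simp: uniform_count_measure_def space_torus_borel)
  then have "emeasure (uniform_on F) A = emeasure (uniform_count_measure F) (A \<inter> F)"
    unfolding uniform_on_def using assms(3)
    by (simp add: emeasure_distr space_uniform_count_measure)
  then show ?thesis
    using assms(1) by (simp add: emeasure_uniform_count_measure Int_commute)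
qed

lemma sets_torus_lincomb: "sets (torus_lincomb cs) = sets torus_borel"
proof -
  have "sigma_algebra torus (sets torus_borel)"
    using sets.sigma_algebra_axioms[of torus_borel] by (simp add: space_torus_borel)
  then show ?thesis
    unfolding torus_lincomb_def
    by (simp add: sets_measure_of_conv sigma_algebra.sigma_sets_eq sigma_algebra_iff2)
qed

text \<open>The combination is the push-forward of a point measure on the finite union
  \<open>P\<close> of the supports with density \<open>w\<close>, so integrals become finite
  sums.\<close>

lemma integral_torus_lincomb_uniform:
  fixes f :: "complex \<times> complex \<Rightarrow> complex"
  assumes cs: "\<And>c F. (c, F) \<in> set cs \<Longrightarrow> 0 \<le> c \<and> finite F \<and> F \<subseteq> torus"
    and f: "f \<in> borel_measurable torus_borel"
  defines "N \<equiv> torus_lincomb (map (\<lambda>(c, F). (c, uniform_on F)) cs)"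
  shows "integrable N f"
    and "integral\<^sup>L N f = (\<Sum>(c, F)\<leftarrow>cs. (c / card F) *\<^sub>R (\<Sum>p\<in>F. f p))"
proof -
  define P where "P = (\<Union>(c, F)\<in>set cs. F)"
  define w where "w p = (\<Sum>(c, F)\<leftarrow>cs. c / card F * indicator F p)" for p
  have P: "finite P" "P \<subseteq> torus" "\<And>c F. (c, F) \<in> set cs \<Longrightarrow> F \<subseteq> P"
    using cs by (auto simp: P_def)
  have w: "0 \<le> w p" for p
    unfolding w_def using cs by (intro sum_list_nonneg) auto
  have meas: "(\<lambda>p. p) \<in> measurable (point_measure P w) torus_borel"
    using P(2) by (auto simp: space_torus_borel)
  have N: "N = distr (point_measure P w) torus_borel (\<lambda>p. p)"
  proof (rule measure_eqI)
    show "sets N = sets (distr (point_measure P w) torus_borel (\<lambda>p. p))"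
      by (simp add: N_def sets_torus_lincomb)
    fix A assume "A \<in> sets N"
    then have A: "A \<in> sets torus_borel" by (simp add: N_def sets_torus_lincomb)
    have scaled: "ennreal c * emeasure (uniform_on F) A = ennreal (c * (card (F \<inter> A) / card F))"
      if "(c, F) \<in> set cs" for c F
      using cs[OF that] A by (simp add: emeasure_uniform_on ennreal_mult del: times_divide_eq_right)
    have "emeasure N A = (\<Sum>(c, M)\<leftarrow>map (\<lambda>(c, F). (c, uniform_on F)) cs. ennreal c * emeasure M A)"
      unfolding N_def by (rule emeasure_torus_lincomb) (use A in \<open>auto simp: uniform_on_def\<close>)
    also have "\<dots> = (\<Sum>(c, F)\<leftarrow>cs. ennreal (c * (card (F \<inter> A) / card F)))"
      by (auto simp: o_def scaled simp del: times_divide_eq_right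
          intro!: arg_cong[of _ _ sum_list] map_cong)
    \<comment> \<open>Pulling \<open>ennreal\<close> out of the sum requires nonnegative
      terms.\<close>
    also have "\<dots> = ennreal (\<Sum>(c, F)\<leftarrow>cs. c * (card (F \<inter> A) / card F))"
      using cs
    proof (induction cs)
      case (Cons x cs)
      obtain c F where x: "x = (c, F)" by force
      have "0 \<le> c" using Cons.prems x by auto
      moreover have "0 \<le> (\<Sum>(c, F)\<leftarrow>cs. c * (card (F \<inter> A) / card F))"
      proof (rule sum_list_nonneg)
        have "0 \<le> c" if "(c, F) \<in> set cs" for c F using Cons.prems that by auto
        then show "0 \<le> r" if "r \<in> set (map (\<lambda>(c, F). c * (card (F \<inter> A) / card F)) cs)" for r
          using that by auto
      qed
      moreover have "(\<Sum>(c, F)\<leftarrow>cs. ennreal (c * (card (F \<inter> A) / card F)))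
          = ennreal (\<Sum>(c, F)\<leftarrow>cs. c * (card (F \<inter> A) / card F))"
        by (rule Cons.IH) (use Cons.prems in auto)
      ultimately show ?case
        by (simp add: x ennreal_plus)
    qed simp
    also have "(\<Sum>(c, F)\<leftarrow>cs. c * (card (F \<inter> A) / card F))
        = (\<Sum>(c, F)\<leftarrow>cs. (c / card F) *\<^sub>R (\<Sum>p\<in>F. indicator A p))"
      using cs by (auto intro!: arg_cong[of _ _ sum_list] map_cong
          simp: sum.If_cases indicator_def Int_def)
    also have "\<dots> = (\<Sum>p\<in>P. w p *\<^sub>R indicator A p)"
      unfolding w_def by (rule sum_weighted_indicators[symmetric]) (use P in auto)
    also have "\<dots> = (\<Sum>p\<in>P \<inter> A. w p)"
      using P(1) by (simp add: sum.inter_restrict indicator_def cong: if_cong)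
    also have "ennreal \<dots> = emeasure (point_measure P w) (A \<inter> P)"
      using P(1) w by (simp add: emeasure_point_measure_finite Int_commute sum_ennreal)
    also have "\<dots> = emeasure (distr (point_measure P w) torus_borel (\<lambda>p. p)) A"
      using meas A by (simp add: emeasure_distr space_point_measure)
    finally show "emeasure N A = emeasure (distr (point_measure P w) torus_borel (\<lambda>p. p)) A" .
  qed
  show "integrable N f"
    unfolding N using meas f P(1) by (simp add: integrable_distr_eq integrable_point_measure_finite)
  have "integral\<^sup>L N f = (\<Sum>p\<in>P. w p *\<^sub>R f p)"
    unfolding N using meas f P(1) w by (simp add: integral_distr lebesgue_integral_point_measure_finite)
  also have "\<dots> = (\<Sum>(c, F)\<leftarrow>cs. (c / card F) *\<^sub>R (\<Sum>p\<in>F. f p))"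
    unfolding w_def by (rule sum_weighted_indicators) (use P in auto)
  finally show "integral\<^sup>L N f = (\<Sum>(c, F)\<leftarrow>cs. (c / card F) *\<^sub>R (\<Sum>p\<in>F. f p))" .
qed

text \<open>Continuity on the torus suffices, where the inverted coordinates do not vanish.\<close>

lemma R_fun_measurable: "R_fun m n \<in> borel_measurable torus_borel"
  unfolding torus_borel_def R_fun_def case_prod_unfold
  by (rule borel_measurable_continuous_on_restrict)
    (auto intro!: continuous_intros simp: torus_def)

section \<open>Integrals over orbits of pairs of roots of unity\<close>

definition torus_point :: "int \<times> int \<Rightarrow> complex \<times> complex" where
  "torus_point = (\<lambda>(x, y). (root24 x, root24 y))"

text \<open>This is \<open>R_fun 1 0\<close> at \<open>torus_point (x, y)\<close>, in
  exponents.\<close>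

definition point_value :: "int \<times> int \<Rightarrow> complex" where
  "point_value = (\<lambda>(x, y). root24 x + root24 (- y) + root24 (y - x))"

text \<open>The six images in additive form; reduction modulo 24 makes distinct exponents stand for
  distinct points.\<close>

definition S3_exponents :: "int \<times> int \<Rightarrow> (int \<times> int) list" where
  "S3_exponents = (\<lambda>(x, y). map (\<lambda>(a, b). (a mod 24, b mod 24))
     [(x, y), (- y, x - y), (y - x, - x), (- y, - x), (y - x, y), (x, x - y)])"

lemma torus_point_mem: "torus_point q \<in> torus"
  by (cases q) (simp add: torus_point_def mem_torus_iff)

lemma torus_point_mod: "torus_point (a mod 24, b mod 24) = torus_point (a, b)"
  by (simp add: torus_point_def root24_eq_iff)

lemma inj_on_torus_point: "inj_on torus_point ({0..<24} \<times> {0..<24})"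
  by (auto simp: inj_on_def torus_point_def root24_eq_iff)

lemma S3_orbit_torus_point: "S3_orbit (torus_point q) = torus_point ` set (S3_exponents q)"
proof -
  obtain x y where q: "q = (x, y)" by force
  have "torus_point ` set (S3_exponents q)
      = torus_point ` {(x, y), (- y, x - y), (y - x, - x), (- y, - x), (y - x, y), (x, x - y)}"
    unfolding q S3_exponents_def by (simp add: torus_point_mod)
  also have "\<dots> = S3_images (torus_point q)"
    by (simp add: q torus_point_def inverse_root24 mult.commute flip: root24_add)
  finally show ?thesis using S3_orbit_eq[OF torus_point_mem] by simp
qed

lemma R_fun_torus_point: "R_fun m n (torus_point q) = point_value q ^ m * cnj (point_value q) ^ n"
proof -
  obtain x y where q: "q = (x, y)" by force
  show ?thesis
    by (simp add: q R_fun_def torus_point_def point_value_def inverse_root24 cnj_root24 add_ac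
        flip: root24_add)
qed

text \<open>The group permutes the three summands of \<open>point_value\<close>.\<close>

lemma R_fun_S3_exponents:
  "q' \<in> set (S3_exponents q) \<Longrightarrow> R_fun m n (torus_point q') = R_fun m n (torus_point q)"
  by (cases q)
    (auto simp: S3_exponents_def torus_point_mod, simp_all add: R_fun_torus_point point_value_def add_ac)

definition torus_point_orbits :: "(int \<times> int) list \<Rightarrow> (complex \<times> complex) set" where
  "torus_point_orbits qs = \<Union> (S3_orbit ` torus_point ` set qs)"

text \<open>Distinctness of the concatenated list says both that each orbit has six points and that
  the orbits are disjoint.\<close>

lemma torus_point_orbits:
  assumes dist: "distinct (concat (map S3_exponents qs))"
  defines "F \<equiv> torus_point_orbits qs"
  shows "finite F" and "F \<subseteq> torus" and "card F = 6 * length qs"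
    and "(\<Sum>p\<in>F. R_fun m n p) = 6 * (\<Sum>q\<leftarrow>qs. point_value q ^ m * cnj (point_value q) ^ n)"
proof -
  let ?S = "concat (map S3_exponents qs)"
  have F: "F = torus_point ` set ?S"
    by (auto simp: F_def torus_point_orbits_def S3_orbit_torus_point)
  have "set (S3_exponents q) \<subseteq> {0..<24} \<times> {0..<24}" for q
    by (cases q) (simp add: S3_exponents_def)
  then have inj: "inj_on torus_point (set ?S)"
    by (intro inj_on_subset[OF inj_on_torus_point]) auto
  show "finite F" by (simp add: F)
  show "F \<subseteq> torus" using torus_point_mem by (auto simp: F)
  have len: "length (S3_exponents q) = 6" for q by (cases q) (simp add: S3_exponents_def)
  have "card F = length ?S" unfolding F card_image[OF inj] by (rule distinct_card[OF dist])
  also have "\<dots> = 6 * length qs"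
    by (simp add: length_concat o_def len sum_list_triv)
  finally show "card F = 6 * length qs" .
  have const: "(\<Sum>q'\<leftarrow>S3_exponents q. R_fun m n (torus_point q')) = 6 * R_fun m n (torus_point q)" for q
  proof -
    have "map (\<lambda>q'. R_fun m n (torus_point q')) (S3_exponents q)
        = map (\<lambda>q'. R_fun m n (torus_point q)) (S3_exponents q)"
      by (rule map_cong) (simp_all add: R_fun_S3_exponents)
    then show ?thesis by (simp only: sum_list_triv len) simp
  qed
  have "(\<Sum>p\<in>F. R_fun m n p) = (\<Sum>q\<leftarrow>?S. R_fun m n (torus_point q))"
    unfolding F using dist by (simp only: sum.reindex[OF inj] sum_list_distinct_conv_sum_set o_def)
  also have "\<dots> = (\<Sum>q\<leftarrow>qs. \<Sum>q'\<leftarrow>S3_exponents q. R_fun m n (torus_point q'))"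
    by (induction qs) simp_all
  also have "\<dots> = (\<Sum>q\<leftarrow>qs. 6 * R_fun m n (torus_point q))"
    by (simp only: const)
  finally show "(\<Sum>p\<in>F. R_fun m n p) = 6 * (\<Sum>q\<leftarrow>qs. point_value q ^ m * cnj (point_value q) ^ n)"
    by (simp only: sum_list_const_mult R_fun_torus_point)
qed

text \<open>Here \<open>tau s = root24 t\<close> with \<open>s = 24 / t\<close> and
  \<open>omega = root24 8\<close>; in \<open>d2_exponents\<close> the parameter of the measure is
  \<open>k / 24\<close>.\<close>

definition d1_exponents :: "int \<Rightarrow> (int \<times> int) list" where
  "d1_exponents t = [(t, t), (- 8 - t, 8), (8, - 8 - t)]"

definition d2_exponents :: "int \<Rightarrow> int \<Rightarrow> (int \<times> int) list" where
  "d2_exponents t k = [(t + k, t), (t, t + k), (- 8 - t, 8 + k), (8 + k, - 8 - t),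
     (- 8 - t - k, 8 - k), (8 - k, - 8 - t - k)]"

lemma tau_eq: "tau (24 / of_int t) = root24 t"
  by (simp add: tau_def root24_def of_rat_divide field_simps)

lemma omega_eq: "omega = root24 8"
  by (simp add: omega_def root24_def field_simps)

lemma cis_eq: "cis (2 * pi * (of_int k / 24)) = root24 k" "cis (- 2 * pi * (of_int k / 24)) = root24 (- k)"
  by (simp_all add: root24_def field_simps)

lemma d1_eq: "d1 (24 / of_int t) = uniform_on (torus_point_orbits (d1_exponents t))"
  unfolding d1_def tau_eq omega_eq cnj_root24
  by (simp add: torus_point_orbits_def d1_exponents_def torus_point_def flip: root24_add)

lemma d2_eq: "d2 (24 / of_int t) (of_int k / 24) = uniform_on (torus_point_orbits (d2_exponents t k))"
  unfolding d2_def tau_eq omega_eq cnj_root24 cis_eq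
  by (simp add: torus_point_orbits_def d2_exponents_def torus_point_def flip: root24_add)

text \<open>By evaluation: the supports have 18 points for each \<open>d1\<close> and 36 for each
  \<open>d2\<close>.\<close>

lemma distinct_exponents:
  "\<forall>t\<in>set [1, 5, 7, 11]. distinct (concat (map S3_exponents (d1_exponents t)))"
  "\<forall>(t, k)\<in>set [(3, 2), (6, 1)]. distinct (concat (map S3_exponents (d2_exponents t k)))"
  by code_simp+

text \<open>Expanding \<open>c^2\<close> and \<open>c^3\<close> for
  \<open>c = root24 t + root24 (- t)\<close> makes the entry linear in roots of unity.\<close>

lemma cos_form_sym_entry:
  "sym_entry (root24 t + root24 (- t)) Li = 6 - 2 * (root24 t + root24 (- t))
    - 2 * (root24 (2 * t) + root24 (- (2 * t))) + (root24 (3 * t) + root24 (- (3 * t)))"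
proof -
  have "root24 t * root24 (- t) = 1" by (simp flip: root24_add)
  moreover have "root24 (- (2 * t)) = root24 (- t) ^ 2" "root24 (- (3 * t)) = root24 (- t) ^ 3"
    "root24 (2 * t) = root24 t ^ 2" "root24 (3 * t) = root24 t ^ 3"
    by (simp_all add: root24_power)
  ultimately show ?thesis
    unfolding sym_entry.simps by algebra
qed

text \<open>Each coefficient is shared equally by the orbits of its measure: three for
  \<open>d1\<close>, six for \<open>d2\<close>.\<close>

lemma E24_weight_values:
  "E24_weight 1 = complex_of_real ((6 - 2 * sqrt 3 - sqrt 6) / 48) / 3"
  "E24_weight 5 = complex_of_real ((6 + 2 * sqrt 3 - sqrt 6) / 48) / 3"
  "E24_weight 7 = complex_of_real ((6 + 2 * sqrt 3 + sqrt 6) / 48) / 3"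
  "E24_weight 11 = complex_of_real ((6 - 2 * sqrt 3 + sqrt 6) / 48) / 3"
  "E24_weight 3 = complex_of_real ((2 - sqrt 2) / 8) / 6"
  "E24_weight 21 = complex_of_real ((2 - sqrt 2) / 8) / 6"
  "E24_weight 9 = complex_of_real ((2 + sqrt 2) / 8) / 6"
  "E24_weight 15 = complex_of_real ((2 + sqrt 2) / 8) / 6"
  unfolding E24_weight_def cos_form_sym_entry antisym_entry.simps root24_power
    of_real_divide of_real_add of_real_diff of_real_mult of_real_numeral sqrt_root24
  by (simp_all add: root24_reduce field_simps)

section \<open>Matching of the orbits with the spectrum\<close>

definition E24_summand :: "nat \<Rightarrow> nat \<Rightarrow> nat \<Rightarrow> int \<Rightarrow> complex" where
  "E24_summand m n i t = (root24 8 ^ i * E24_eigenvalue t) ^ m * cnj (root24 8 ^ i * E24_eigenvalue t) ^ n"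

lemma point_value_d1:
  assumes "t \<in> {1, 5, 7, 11}"
  shows "point_value (t, t) = root24 8 ^ 0 * E24_eigenvalue t"
    "point_value (8, - 8 - t) = root24 8 ^ 1 * E24_eigenvalue t"
    "point_value (- 8 - t, 8) = root24 8 ^ 2 * E24_eigenvalue t"
  using assms
  by (auto simp: point_value_def E24_eigenvalue_def root24_power distrib_left simp flip: root24_add)
    (simp_all add: root24_reduce)

text \<open>Swapping the coordinates of a point conjugates its value. Hence each measure carries two
  exponents that are opposite modulo 24: 3 with 21, and 9 with 15.\<close>

lemma point_value_d2:
  "point_value (5, 3) = root24 8 ^ 2 * E24_eigenvalue 3"
  "point_value (3, 5) = root24 8 ^ 1 * E24_eigenvalue 21"
  "point_value (- 11, 10) = root24 8 ^ 1 * E24_eigenvalue 3"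
  "point_value (10, - 11) = root24 8 ^ 2 * E24_eigenvalue 21"
  "point_value (- 13, 6) = root24 8 ^ 0 * E24_eigenvalue 21"
  "point_value (6, - 13) = root24 8 ^ 0 * E24_eigenvalue 3"
  "point_value (7, 6) = root24 8 ^ 0 * E24_eigenvalue 9"
  "point_value (6, 7) = root24 8 ^ 0 * E24_eigenvalue 15"
  "point_value (- 14, 9) = root24 8 ^ 2 * E24_eigenvalue 9"
  "point_value (9, - 14) = root24 8 ^ 1 * E24_eigenvalue 15"
  "point_value (- 15, 7) = root24 8 ^ 2 * E24_eigenvalue 15"
  "point_value (7, - 15) = root24 8 ^ 1 * E24_eigenvalue 9"
  by (simp_all add: point_value_def E24_eigenvalue_def root24_power distrib_left flip: root24_add)
    (simp_all add: root24_reduce)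

lemma length_exponents: "length (d1_exponents t) = 3" "length (d2_exponents t k) = 6"
  by (simp_all add: d1_exponents_def d2_exponents_def)

lemma sum_point_values:
  "t \<in> {1, 5, 7, 11} \<Longrightarrow> (\<Sum>q\<leftarrow>d1_exponents t. point_value q ^ m * cnj (point_value q) ^ n)
    = (\<Sum>i\<in>{0, 1, 2}. E24_summand m n i t)"
  "(\<Sum>q\<leftarrow>d2_exponents 3 2. point_value q ^ m * cnj (point_value q) ^ n)
    = (\<Sum>i\<in>{0, 1, 2}. E24_summand m n i 3) + (\<Sum>i\<in>{0, 1, 2}. E24_summand m n i 21)"
  "(\<Sum>q\<leftarrow>d2_exponents 6 1. point_value q ^ m * cnj (point_value q) ^ n)
    = (\<Sum>i\<in>{0, 1, 2}. E24_summand m n i 9) + (\<Sum>i\<in>{0, 1, 2}. E24_summand m n i 15)"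
proof -
  have sum3: "(\<Sum>i\<in>{0, 1, 2::nat}. f i) = f 0 + f 1 + f 2" for f :: "nat \<Rightarrow> complex"
    by (simp add: add_ac)
  have d2: "d2_exponents 3 2 = [(5, 3), (3, 5), (- 11, 10), (10, - 11), (- 13, 6), (6, - 13)]"
    "d2_exponents 6 1 = [(7, 6), (6, 7), (- 14, 9), (9, - 14), (- 15, 7), (7, - 15)]"
    by (simp_all add: d2_exponents_def)
  show "(\<Sum>q\<leftarrow>d1_exponents t. point_value q ^ m * cnj (point_value q) ^ n)
      = (\<Sum>i\<in>{0, 1, 2}. E24_summand m n i t)" if "t \<in> {1, 5, 7, 11}"
    by (simp only: d1_exponents_def list.map sum_list.Cons sum_list.Nil point_value_d1[OF that]
        E24_summand_def sum3 add_ac add_0_left add_0_right)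
  show "(\<Sum>q\<leftarrow>d2_exponents 3 2. point_value q ^ m * cnj (point_value q) ^ n)
      = (\<Sum>i\<in>{0, 1, 2}. E24_summand m n i 3) + (\<Sum>i\<in>{0, 1, 2}. E24_summand m n i 21)"
    "(\<Sum>q\<leftarrow>d2_exponents 6 1. point_value q ^ m * cnj (point_value q) ^ n)
      = (\<Sum>i\<in>{0, 1, 2}. E24_summand m n i 9) + (\<Sum>i\<in>{0, 1, 2}. E24_summand m n i 15)"
    by (simp_all only: d2 list.map sum_list.Cons sum_list.Nil point_value_d2
        E24_summand_def sum3 add_ac add_0_left add_0_right)
qed

text \<open>Needed because \<open>torus_lincomb\<close> sends negative coefficients to 0. The bounds
  fit exactly: \<open>6 - 2 * (7 / 4) - 5 / 2 = 0\<close>.\<close>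

lemma E24_coefficients_nonneg:
  "0 \<le> 6 - 2 * sqrt 3 - sqrt 6" "0 \<le> 6 + 2 * sqrt 3 - sqrt 6" "0 \<le> 6 + 2 * sqrt 3 + sqrt 6"
  "0 \<le> 6 - 2 * sqrt 3 + sqrt 6" "0 \<le> 2 - sqrt 2" "0 \<le> 2 + sqrt 2"
proof -
  have "sqrt 3 \<le> 7 / 4" "sqrt 6 \<le> 5 / 2" "sqrt 2 \<le> 2"
    by (rule real_le_lsqrt; simp add: power2_eq_square)+
  moreover have "0 \<le> sqrt 3" "0 \<le> sqrt 6" "0 \<le> sqrt 2" by simp_all
  ultimately show "0 \<le> 6 - 2 * sqrt 3 - sqrt 6" "0 \<le> 6 + 2 * sqrt 3 - sqrt 6"
    "0 \<le> 6 + 2 * sqrt 3 + sqrt 6" "0 \<le> 6 - 2 * sqrt 3 + sqrt 6" "0 \<le> 2 - sqrt 2" "0 \<le> 2 + sqrt 2"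
    by linarith+
qed

theorem theorem2p8:
  shows "spectral_measure E24 E24_star (torus_lincomb
    [((6 - 2 * sqrt 3 - sqrt 6) / 48, d1 24),
     ((6 + 2 * sqrt 3 - sqrt 6) / 48, d1 (24 / 5)),
     ((6 + 2 * sqrt 3 + sqrt 6) / 48, d1 (24 / 7)),
     ((6 - 2 * sqrt 3 + sqrt 6) / 48, d1 (24 / 11)),
     ((2 - sqrt 2) / 8, d2 8 (1 / 12)),
     ((2 + sqrt 2) / 8, d2 4 (1 / 24))])"
proof -
  \<comment> \<open>The last two entries use \<open>8 = 24 / 3\<close>,
    \<open>1 / 12 = 2 / 24\<close> and \<open>4 = 24 / 6\<close>.\<close>
  define L :: "(real \<times> (int \<times> int) list) list" where "L =
    [((6 - 2 * sqrt 3 - sqrt 6) / 48, d1_exponents 1),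
     ((6 + 2 * sqrt 3 - sqrt 6) / 48, d1_exponents 5),
     ((6 + 2 * sqrt 3 + sqrt 6) / 48, d1_exponents 7),
     ((6 - 2 * sqrt 3 + sqrt 6) / 48, d1_exponents 11),
     ((2 - sqrt 2) / 8, d2_exponents 3 2),
     ((2 + sqrt 2) / 8, d2_exponents 6 1)]"
  define cs where "cs = map (\<lambda>(c, qs). (c, torus_point_orbits qs)) L"
  define M where "M = torus_lincomb (map (\<lambda>(c, F). (c, uniform_on F)) cs)"
  have L: "0 \<le> c \<and> distinct (concat (map S3_exponents qs))" if "(c, qs) \<in> set L" for c qs
    using that E24_coefficients_nonneg distinct_exponents
    by (auto simp: L_def) (use E24_coefficients_nonneg in linarith)+
  have cs: "0 \<le> c \<and> finite F \<and> F \<subseteq> torus" if "(c, F) \<in> set cs" for c F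
    using that L torus_point_orbits(1,2) by (fastforce simp: cs_def)
  have "integral\<^sup>L M (R_fun m n) = (\<Sum>i\<in>{0, 1, 2}. \<Sum>t\<in>E24_exponents. E24_weight t * E24_summand m n i t)"
    for m n
  proof -
    have "integral\<^sup>L M (R_fun m n) = (\<Sum>(c, F)\<leftarrow>cs. (c / card F) *\<^sub>R (\<Sum>p\<in>F. R_fun m n p))"
      unfolding M_def by (rule integral_torus_lincomb_uniform(2)[OF cs R_fun_measurable])
    \<comment> \<open>The orbit size 6 cancels, so averages over points become averages over orbit
      representatives.\<close>
    also have "\<dots> = (\<Sum>(c, qs)\<leftarrow>L. complex_of_real c / of_nat (length qs)
        * (\<Sum>q\<leftarrow>qs. point_value q ^ m * cnj (point_value q) ^ n))"
      unfolding cs_def using L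
      by (auto simp: o_def torus_point_orbits(3,4) scaleR_conv_of_real
          intro!: arg_cong[of _ _ sum_list] map_cong)
    also have "\<dots> = (\<Sum>t\<in>E24_exponents. E24_weight t * (\<Sum>i\<in>{0, 1, 2}. E24_summand m n i t))"
    proof -
      \<comment> \<open>Folding the inner sums into \<open>S\<close> leaves an identity linear in
        the \<open>S t\<close>, whose coefficients are the weights.\<close>
      define S where "S t = (\<Sum>i\<in>{0, 1, 2}. E24_summand m n i t)" for t
      show ?thesis
        unfolding L_def S_def[symmetric]
        using sum_point_values(1)[of 1 m n, folded S_def] sum_point_values(1)[of 5 m n, folded S_def]
          sum_point_values(1)[of 7 m n, folded S_def] sum_point_values(1)[of 11 m n, folded S_def]
          sum_point_values(2,3)[of m n, folded S_def]
        by (simp add: length_exponents E24_weight_values E24_exponents_def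
            algebra_simps add_divide_distrib del: of_real_divide of_real_add of_real_diff)
    qed
    also have "\<dots> = (\<Sum>i\<in>{0, 1, 2}. \<Sum>t\<in>E24_exponents. E24_weight t * E24_summand m n i t)"
      unfolding sum_distrib_left by (rule sum.swap)
    finally show ?thesis .
  qed
  moreover have "integrable M (R_fun m n)" for m n
    unfolding M_def by (rule integral_torus_lincomb_uniform(1)[OF cs R_fun_measurable])
  ultimately have "spectral_measure E24 E24_star M"
    using E24_fin_digraph E24_normal
    by (simp only: spectral_measure_def E24_moments E24_summand_def)
      (simp add: M_def sets_torus_lincomb E24_def)
  moreover have "M = torus_lincomb
    [((6 - 2 * sqrt 3 - sqrt 6) / 48, d1 24),
     ((6 + 2 * sqrt 3 - sqrt 6) / 48, d1 (24 / 5)),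
     ((6 + 2 * sqrt 3 + sqrt 6) / 48, d1 (24 / 7)),
     ((6 - 2 * sqrt 3 + sqrt 6) / 48, d1 (24 / 11)),
     ((2 - sqrt 2) / 8, d2 8 (1 / 12)),
     ((2 + sqrt 2) / 8, d2 4 (1 / 24))]"
    using d1_eq[of 1] d1_eq[of 5] d1_eq[of 7] d1_eq[of 11] d2_eq[of 3 2] d2_eq[of 6 1]
    by (simp add: M_def cs_def L_def)
  ultimately show ?thesis by simp
qed

end
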